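(* For a positive integer $n$, let $P(n)$ be the largest size of a set of permutations of $[n]=\{1,\dots,n\}$ any two distinct members of which are locally parallel. Then $$\frac{n!}{6^n}<P(n)\le \frac{n!}{6^{\lfloor n/3\rfloor}}.$$
   Context: A permutation of $[n]$ is a bijection $[n]\to[n]$; for a permutation $\sigma$ and $a\in[n]$, $\sigma^{-1}(a)$ is the position of $a$ when $\sigma$ is viewed as the linear order $\sigma(1),\dots,\sigma(n)$. Two permutations $\sigma,\tau$ of $[n]$ are called locally parallel if there exist two distinct elements $a,b\in[n]$ such that $\sigma^{-1}(a)<\sigma^{-1}(b)$, $\tau^{-1}(b)<\tau^{-1}(a)$, and $[\sigma^{-1}(a),\sigma^{-1}(b)]\cap[\tau^{-1}(b),\tau^{-1}(a)]=\emptyset$ (intervals of integers/positions). *)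

theory Defs
  imports Complex_Main "HOL-Combinatorics.Permutations"
begin

(* A permutation s with "s permutes {1..n}" is read as the word s 1, ..., s n,
   so that inv s a is the position of a. *)
definition locally_parallel :: "nat \<Rightarrow> (nat \<Rightarrow> nat) \<Rightarrow> (nat \<Rightarrow> nat) \<Rightarrow> bool" where
  "locally_parallel n \<sigma> \<tau> \<longleftrightarrow>
    (\<exists>a\<in>{1..n}. \<exists>b\<in>{1..n}. a \<noteq> b \<and> inv \<sigma> a < inv \<sigma> b \<and> inv \<tau> b < inv \<tau> a \<and>
       {inv \<sigma> a..inv \<sigma> b} \<inter> {inv \<tau> b..inv \<tau> a} = {})"

definition locally_parallel_family :: "nat \<Rightarrow> (nat \<Rightarrow> nat) set \<Rightarrow> bool" where
  "locally_parallel_family n F \<longleftrightarrow>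
    F \<subseteq> {\<sigma>. \<sigma> permutes {1..n}} \<and> pairwise (locally_parallel n) F"

(* The Max is over a finite nonempty set: there are finitely many permutations of {1..n},
   and the empty family qualifies. *)
definition max_locally_parallel :: "nat \<Rightarrow> nat" where
  "max_locally_parallel n = Max {card F | F. locally_parallel_family n F}"

end

theory Submission
  imports Defs "HOL-Library.FuncSet"
begin

text \<open>
  Upper bound: split the positions into consecutive blocks of three. Two words that differ only by
  rearrangements inside blocks are never locally parallel, because two intervals of at least two
  positions inside a block of three meet. Hence each class of at least $6^{n\,\mathrm{div}\,3}$
  such words contains at most one member of the family.

  Lower bound: put \<open>\<pi> = inv \<tau> \<circ> \<sigma>\<close>. Then \<open>\<sigma>\<close> and \<open>\<tau>\<close> fail to be locally parallel iff in every
  inversion \<open>i < j\<close>, \<open>\<pi> j < \<pi> i\<close> one has \<open>i \<le> \<pi> i\<close> and \<open>\<pi> j \<le> j\<close>. So \<open>\<pi>\<close> is increasing on its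
  excedances and on its anti-excedances, and is determined by the sets of positions and of values
  of each kind: there are five possibilities for each index, so at most $5^n$ such \<open>\<tau>\<close> for a given
  \<open>\<sigma>\<close>, and a maximum family covers all permutations by such sets.
\<close>

section \<open>Symmetry, irreflexivity and attainment of the maximum\<close>

lemma locally_parallel_commute: "locally_parallel n \<sigma> \<tau> \<longleftrightarrow> locally_parallel n \<tau> \<sigma>"
  unfolding locally_parallel_def by (metis Int_commute)

lemma not_locally_parallel_self: "\<not> locally_parallel n \<sigma> \<sigma>"
  unfolding locally_parallel_def by auto

lemma locally_parallel_family_finite:
  assumes "locally_parallel_family n F"
  shows "finite F"
  using assms finite_permutations[of "{1..n}"] finite_subset
  unfolding locally_parallel_family_def by blast

lemma finite_locally_parallel_families: "finite {card F | F. locally_parallel_family n F}"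
proof -
  have "{F. locally_parallel_family n F} \<subseteq> Pow {\<sigma>. \<sigma> permutes {1..n}}"
    unfolding locally_parallel_family_def by blast
  then have "finite {F. locally_parallel_family n F}"
    by (rule finite_subset) (simp add: finite_permutations)
  then show ?thesis by simp
qed

lemma card_le_max_locally_parallel:
  "locally_parallel_family n F \<Longrightarrow> card F \<le> max_locally_parallel n"
  unfolding max_locally_parallel_def
  by (rule Max_ge[OF finite_locally_parallel_families]) blast

lemma max_locally_parallel_attained:
  obtains F where "locally_parallel_family n F" "card F = max_locally_parallel n"
proof -
  have "locally_parallel_family n {}"
    by (simp add: locally_parallel_family_def)
  then have "{card F | F. locally_parallel_family n F} \<noteq> {}" by blast
  then have "max_locally_parallel n \<in> {card F | F. locally_parallel_family n F}"
    unfolding max_locally_parallel_def by (rule Max_in[OF finite_locally_parallel_families])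
  then show thesis using that by auto
qed

subsection \<open>Rearrangements inside blocks of three\<close>

text \<open>The blocks are \<open>{1,2,3}\<close>, \<open>{4,5,6}\<close>, \dots.\<close>

definition block_perms :: "nat \<Rightarrow> (nat \<Rightarrow> nat) set" where
  "block_perms m = {g. g permutes {1..3 * m} \<and> (\<forall>x. (g x + 2) div 3 = (x + 2) div 3)}"

lemma finite_block_perms: "finite (block_perms m)"
  by (rule finite_subset[OF _ finite_permutations[of "{1..3 * m}"]]) (auto simp: block_perms_def)

text \<open>By induction: composing each member for \<open>m\<close> blocks with each of the six
  permutations of the next block \<open>S\<close> yields distinct members for \<open>Suc m\<close>
  blocks.\<close>

lemma card_block_perms: "6 ^ m \<le> card (block_perms m)"
proof (induction m)
  case 0
  have "id \<in> block_perms 0" by (auto simp: block_perms_def permutes_id)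
  then have "card (block_perms 0) > 0" using finite_block_perms card_gt_0_iff by blast
  then show ?case by simp
next
  case (Suc m)
  define S where "S = {3 * m + 1..3 * m + 3}"
  define Q where "Q = {p. p permutes S}"
  have cQ: "card Q = 6" unfolding Q_def
    by (subst card_permutations[of S 3]) (auto simp: S_def fact_numeral)
  have fix_S: "g x = x" if "g \<in> block_perms m" "x \<in> S" for g x
    using that by (intro permutes_not_in[of g "{1..3*m}"]) (auto simp: block_perms_def S_def)
  have in_block: "(x + 2) div 3 = m + 1" if "x \<in> S" for x
    using that unfolding S_def by auto
  have inj: "inj_on (\<lambda>(g, p). g \<circ> p) (block_perms m \<times> Q)"
  proof (rule inj_onI, clarify)
    fix g p h q
    assume g: "g \<in> block_perms m" and p: "p \<in> Q" and h: "h \<in> block_perms m" and q: "q \<in> Q"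
      and eq: "g \<circ> p = h \<circ> q"
    \<comment> \<open>On \<open>S\<close> the composites reduce to \<open>p\<close> and
      \<open>q\<close>, since \<open>g\<close> and \<open>h\<close> fix \<open>S\<close> pointwise;
      off \<open>S\<close> both \<open>p\<close> and \<open>q\<close> are the identity.\<close>
    have "p x = q x" for x
    proof (cases "x \<in> S")
      case True
      then have "p x \<in> S" "q x \<in> S"
        using p q permutes_in_image unfolding Q_def by fastforce+
      then show ?thesis using fix_S[OF g] fix_S[OF h] fun_cong[OF eq, of x] by simp
    next
      case False
      then show ?thesis using p q unfolding Q_def by (metis mem_Collect_eq permutes_not_in)
    qed
    then have pq: "p = q" by auto
    have "g = h"
    proof
      fix y
      have "surj q" using q permutes_surj unfolding Q_def by auto
      then obtain x where "y = q x" by blast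
      then show "g y = h y" using fun_cong[OF eq, of x] pq by simp
    qed
    with pq show "g = h \<and> p = q" by simp
  qed
  have sub: "(\<lambda>(g, p). g \<circ> p) ` (block_perms m \<times> Q) \<subseteq> block_perms (Suc m)"
  proof clarify
    fix g p assume g: "g \<in> block_perms m" and p: "p \<in> Q"
    have "g permutes {1..3 * Suc m}"
      by (rule permutes_subset[of _ "{1..3*m}"]) (use g in \<open>auto simp: block_perms_def\<close>)
    moreover have "p permutes {1..3 * Suc m}"
      by (rule permutes_subset[of _ S]) (use p in \<open>auto simp: Q_def S_def\<close>)
    ultimately have "(g \<circ> p) permutes {1..3 * Suc m}" by (metis permutes_compose)
    moreover have "(p x + 2) div 3 = (x + 2) div 3" for x
    proof (cases "x \<in> S")
      case True
      then have "p x \<in> S" using p permutes_in_image unfolding Q_def by fastforce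
      then show ?thesis using True in_block by simp
    next
      case False
      then have "p x = x" using p permutes_not_in[of p S x] by (simp add: Q_def)
      then show ?thesis by simp
    qed
    ultimately show "g \<circ> p \<in> block_perms (Suc m)" using g by (simp add: block_perms_def)
  qed
  have "6 ^ Suc m \<le> card (block_perms m \<times> Q)"
    using Suc cQ by (simp add: card_cartesian_product)
  also have "\<dots> = card ((\<lambda>(g, p). g \<circ> p) ` (block_perms m \<times> Q))"
    by (simp only: card_image[OF inj])
  also have "\<dots> \<le> card (block_perms (Suc m))"
    by (rule card_mono[OF finite_block_perms sub])
  finally show ?case .
qed

text \<open>Disjointness puts one interval entirely to the left of the other. If the
  \<sigma>-interval is on the left, the two positions of \<open>a\<close> enclose both positions of
  \<open>b\<close> and so differ by at least 3; otherwise the same happens to \<open>b\<close>.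
  Positions in one block differ by at most 2.\<close>

lemma not_locally_parallel_if_same_blocks:
  assumes "\<And>a. (inv \<sigma> a + 2) div 3 = (inv \<tau> a + 2) div 3"
  shows "\<not> locally_parallel n \<sigma> \<tau>"
proof
  assume "locally_parallel n \<sigma> \<tau>"
  then obtain a b where ab: "inv \<sigma> a < inv \<sigma> b" "inv \<tau> b < inv \<tau> a"
    and disj: "{inv \<sigma> a..inv \<sigma> b} \<inter> {inv \<tau> b..inv \<tau> a} = {}"
    unfolding locally_parallel_def by blast
  have "inv \<sigma> b < inv \<tau> b \<or> inv \<tau> a < inv \<sigma> a"
  proof (rule ccontr)
    assume "\<not> ?thesis"
    then have "max (inv \<sigma> a) (inv \<tau> b) \<in> {inv \<sigma> a..inv \<sigma> b} \<inter> {inv \<tau> b..inv \<tau> a}"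
      using ab by auto
    with disj show False by blast
  qed
  moreover have near: "y \<le> x + 2" if "(x + 2) div 3 = (y + 2) div 3" for x y :: nat
    using that by linarith
  ultimately show False
    using ab near[OF assms[of a]] near[OF assms[of b, symmetric]] by linarith
qed

text \<open>The classes \<open>\<sigma> \<circ> g\<close>, with \<open>g\<close> in
  \<open>block_perms\<close>, are disjoint for distinct members \<sigma> of \<open>F\<close>: a
  common word would place every \<open>a\<close> in the same block under both members.\<close>

lemma card_locally_parallel_family_le:
  assumes F: "locally_parallel_family n F"
  shows "card F * 6 ^ (n div 3) \<le> fact n"
proof -
  define m where "m = n div 3"
  have perm: "\<sigma> permutes {1..n}" if "\<sigma> \<in> F" for \<sigma>
    using that F unfolding locally_parallel_family_def by blast
  have gperm: "g permutes {1..n}" if "g \<in> block_perms m" for g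
    by (rule permutes_subset[of _ "{1..3*m}"]) (use that in \<open>auto simp: block_perms_def m_def\<close>)
  have blk: "(g x + 2) div 3 = (x + 2) div 3" if "g \<in> block_perms m" for g x
    using that by (simp add: block_perms_def)
  have inj: "inj_on (\<lambda>(\<sigma>, g). \<sigma> \<circ> g) (F \<times> block_perms m)"
  proof (rule inj_onI, clarify)
    fix \<sigma> g \<tau> h
    assume s: "\<sigma> \<in> F" and g: "g \<in> block_perms m" and t: "\<tau> \<in> F" and h: "h \<in> block_perms m"
      and eq: "\<sigma> \<circ> g = \<tau> \<circ> h"
    have "(inv \<sigma> a + 2) div 3 = (inv \<tau> a + 2) div 3" for a
    proof -
      obtain x where x: "a = \<sigma> (g x)"
        by (metis perm[OF s] gperm[OF g] permutes_inverses(1))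
      then have "a = \<tau> (h x)" using fun_cong[OF eq, of x] by simp
      then have "inv \<tau> a = h x" "inv \<sigma> a = g x"
        using x permutes_inverses(2)[OF perm[OF s]] permutes_inverses(2)[OF perm[OF t]] by metis+
      then show ?thesis using blk g h by simp
    qed
    then have "\<not> locally_parallel n \<sigma> \<tau>" by (rule not_locally_parallel_if_same_blocks)
    then have st: "\<sigma> = \<tau>"
      using F s t unfolding locally_parallel_family_def pairwise_def by blast
    have "g = h"
    proof
      fix x show "g x = h x"
        using fun_cong[OF eq, of x] st permutes_inj[OF perm[OF s]] by (simp add: inj_eq)
    qed
    with st show "\<sigma> = \<tau> \<and> g = h" by simp
  qed
  have "card F * 6 ^ m \<le> card (F \<times> block_perms m)"
    using card_block_perms by (simp add: card_cartesian_product)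
  also have "\<dots> = card ((\<lambda>(\<sigma>, g). \<sigma> \<circ> g) ` (F \<times> block_perms m))"
    by (simp only: card_image[OF inj])
  also have "\<dots> \<le> card {\<sigma>. \<sigma> permutes {1..n}}"
    by (rule card_mono[OF finite_permutations], simp, clarify, rule permutes_compose[OF gperm perm])
  also have "\<dots> = fact n" by (subst card_permutations[of _ n]) auto
  finally show ?thesis by (simp add: m_def)
qed

subsection \<open>Permutations not locally parallel to a given one\<close>

text \<open>An increasing bijection from a well-ordered set onto a given image is unique; this
  recovers a permutation from the sets of its excedance positions and values, and likewise for
  anti-excedances.\<close>

lemma strict_mono_on_same_image_eq:
  fixes f g :: "'a::wellorder \<Rightarrow> 'b::linorder"
  assumes f: "strict_mono_on A f" and g: "strict_mono_on A g" and im: "f ` A = g ` A"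
    and x: "x \<in> A"
  shows "f x = g x"
  using x
proof (induction x rule: less_induct)
  case (less x)
  obtain y where y: "y \<in> A" "f x = g y" using im less.prems by blast
  obtain z where z: "z \<in> A" "g x = f z" using im less.prems by blast
  \<comment> \<open>A smaller \<open>y\<close> would satisfy \<open>f y = g y = f x\<close> by
    induction, against strictness.\<close>
  have "x \<le> y"
    using less.IH[of y] y strict_mono_onD[OF f, of y x] less.prems by (metis less_irrefl not_le)
  then have "g x \<le> f x"
    using strict_mono_on_leD[OF g less.prems y(1)] y(2) by metis
  have "x \<le> z"
    using less.IH[of z] z strict_mono_onD[OF g, of z x] less.prems by (metis less_irrefl not_le)
  then have "f x \<le> g x"
    using strict_mono_on_leD[OF f less.prems z(1)] z(2) by metis
  with \<open>g x \<le> f x\<close> show ?case by (rule order.antisym[rotated])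
qed

text \<open>For an inversion, the two inequalities say exactly that the intervals
  \<open>{i..j}\<close> and \<open>{\<pi> j..\<pi> i}\<close> meet.\<close>

definition inversions_cross_diagonal :: "nat \<Rightarrow> (nat \<Rightarrow> nat) \<Rightarrow> bool" where
  "inversions_cross_diagonal n \<pi> \<longleftrightarrow>
    (\<forall>i\<in>{1..n}. \<forall>j\<in>{1..n}. i < j \<longrightarrow> \<pi> j < \<pi> i \<longrightarrow> i \<le> \<pi> i \<and> \<pi> j \<le> j)"

text \<open>Test the pair \<open>a = \<sigma> i\<close>, \<open>b = \<sigma> j\<close>: the
  \<sigma>-positions are \<open>i\<close>, \<open>j\<close> and the \<tau>-positions are their
  images under \<open>inv \<tau> \<circ> \<sigma>\<close>.\<close>

lemma inversions_cross_diagonal_if_not_locally_parallel: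
  assumes s: "\<sigma> permutes {1..n}" and np: "\<not> locally_parallel n \<sigma> \<tau>"
  shows "inversions_cross_diagonal n (inv \<tau> \<circ> \<sigma>)"
  unfolding inversions_cross_diagonal_def
proof (intro ballI impI)
  fix i j assume ij: "i \<in> {1..n}" "j \<in> {1..n}" "i < j" "(inv \<tau> \<circ> \<sigma>) j < (inv \<tau> \<circ> \<sigma>) i"
  have "\<sigma> i \<in> {1..n}" "\<sigma> j \<in> {1..n}" using ij s permutes_in_image by fastforce+
  moreover have "inv \<sigma> (\<sigma> i) = i" "inv \<sigma> (\<sigma> j) = j"
    using permutes_inverses(2)[OF s] by auto
  moreover have "\<sigma> i \<noteq> \<sigma> j" using ij by auto
  ultimately have "{i..j} \<inter> {(inv \<tau> \<circ> \<sigma>) j..(inv \<tau> \<circ> \<sigma>) i} \<noteq> {}"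
    using np ij unfolding locally_parallel_def by (metis comp_apply)
  then show "i \<le> (inv \<tau> \<circ> \<sigma>) i \<and> (inv \<tau> \<circ> \<sigma>) j \<le> j" by force
qed

text \<open>The kind of \<open>i\<close> as a position and as a value; it is a fixed point in one role iff in the
  other, hence five codes.\<close>

definition excedance_code :: "nat \<Rightarrow> (nat \<Rightarrow> nat) \<Rightarrow> nat \<Rightarrow> nat" where
  "excedance_code n \<pi> = (\<lambda>i\<in>{1..n}. if \<pi> i = i then 0 else
     1 + of_bool (i < \<pi> i) + 2 * of_bool (inv \<pi> i < i))"

lemma excedance_code_eqD:
  assumes eq: "excedance_code n \<pi> = excedance_code n \<rho>" and i: "i \<in> {1..n}"
  shows "\<pi> i = i \<longleftrightarrow> \<rho> i = i"
    and "i < \<pi> i \<longleftrightarrow> i < \<rho> i"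
    and "\<pi> i \<noteq> i \<Longrightarrow> inv \<pi> i < i \<longleftrightarrow> inv \<rho> i < i"
  using fun_cong[OF eq, of i] i
  by (auto simp: excedance_code_def of_bool_def split: if_splits)

text \<open>Equal codes give equal sets of excedances and of anti-excedances and equal images of
  these sets. Monotonicity on each set then forces equal values, and the remaining indices are fixed
  points.\<close>

lemma inj_on_excedance_code:
  "inj_on (excedance_code n) {\<pi>. \<pi> permutes {1..n} \<and> inversions_cross_diagonal n \<pi>}"
proof (rule inj_onI, clarify)
  fix \<pi> \<rho>
  assume p: "\<pi> permutes {1..n}" and r: "\<rho> permutes {1..n}"
    and cp: "inversions_cross_diagonal n \<pi>" and cr: "inversions_cross_diagonal n \<rho>"
    and eq: "excedance_code n \<pi> = excedance_code n \<rho>"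
  define A where "A \<mu> = {i \<in> {1..n}. i < \<mu> i}" for \<mu> :: "nat \<Rightarrow> nat"
  define B where "B \<mu> = {i \<in> {1..n}. \<mu> i < i}" for \<mu> :: "nat \<Rightarrow> nat"
  have monoA: "strict_mono_on (A \<mu>) \<mu>" and monoB: "strict_mono_on (B \<mu>) \<mu>"
    if m: "\<mu> permutes {1..n}" "inversions_cross_diagonal n \<mu>" for \<mu>
  proof -
    \<comment> \<open>An inversion would need both \<open>i \<le> \<mu> i\<close> and
      \<open>\<mu> j \<le> j\<close>. The left index violates this in \<open>B \<mu>\<close>, the
      right index in \<open>A \<mu>\<close>.\<close>
    have key: "\<mu> i < \<mu> j" if "i \<in> {1..n}" "j \<in> {1..n}" "i < j" "\<mu> i < i \<or> j < \<mu> j" for i j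
    proof -
      have "\<mu> i \<noteq> \<mu> j" using permutes_inj[OF m(1)] that by (simp add: inj_eq)
      moreover have "\<not> \<mu> j < \<mu> i"
        using m(2) that unfolding inversions_cross_diagonal_def by fastforce
      ultimately show ?thesis by simp
    qed
    show "strict_mono_on (A \<mu>) \<mu>" "strict_mono_on (B \<mu>) \<mu>"
      by (auto intro!: strict_mono_onI key simp: A_def B_def)
  qed
  have imA: "\<mu> ` A \<mu> = {v \<in> {1..n}. \<mu> v \<noteq> v \<and> inv \<mu> v < v}"
    and imB: "\<mu> ` B \<mu> = {v \<in> {1..n}. \<mu> v \<noteq> v \<and> \<not> inv \<mu> v < v}"
    if m: "\<mu> permutes {1..n}" for \<mu>
  proof -
    have inv1: "inv \<mu> (\<mu> x) = x" and inv2: "\<mu> (inv \<mu> x) = x" for x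
      using permutes_inverses[OF m] by auto
    have inn: "\<mu> x \<in> {1..n} \<longleftrightarrow> x \<in> {1..n}" "inv \<mu> x \<in> {1..n} \<longleftrightarrow> x \<in> {1..n}" for x
      using permutes_in_image[OF m] permutes_in_image[OF permutes_inv[OF m]] by auto
    \<comment> \<open>This turns "\<open>v\<close> is moved as a position" into "\<open>v\<close> is
      moved as a value", so that the negation of \<open>inv \<mu> v < v\<close> becomes the strict
      \<open>v < inv \<mu> v\<close>.\<close>
    have fx: "\<mu> v = v \<longleftrightarrow> inv \<mu> v = v" for v by (metis inv1 inv2)
    show "\<mu> ` A \<mu> = {v \<in> {1..n}. \<mu> v \<noteq> v \<and> inv \<mu> v < v}"
    proof (intro set_eqI iffI)
      fix v assume "v \<in> \<mu> ` A \<mu>"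
      then show "v \<in> {v \<in> {1..n}. \<mu> v \<noteq> v \<and> inv \<mu> v < v}"
        using inn(1) unfolding A_def fx by (auto simp: inv1 simp del: atLeastAtMost_iff)
    next
      fix v assume "v \<in> {v \<in> {1..n}. \<mu> v \<noteq> v \<and> inv \<mu> v < v}"
      then have "inv \<mu> v \<in> A \<mu>" using inn(2)[of v] by (auto simp: A_def inv2)
      then show "v \<in> \<mu> ` A \<mu>" by (metis inv2 imageI)
    qed
    show "\<mu> ` B \<mu> = {v \<in> {1..n}. \<mu> v \<noteq> v \<and> \<not> inv \<mu> v < v}"
    proof (intro set_eqI iffI)
      fix v assume "v \<in> \<mu> ` B \<mu>"
      then show "v \<in> {v \<in> {1..n}. \<mu> v \<noteq> v \<and> \<not> inv \<mu> v < v}"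
        using inn(1) unfolding B_def fx by (auto simp: inv1 simp del: atLeastAtMost_iff)
    next
      fix v assume "v \<in> {v \<in> {1..n}. \<mu> v \<noteq> v \<and> \<not> inv \<mu> v < v}"
      then have "inv \<mu> v \<in> B \<mu>" using inn(2)[of v] unfolding fx by (auto simp: B_def inv2)
      then show "v \<in> \<mu> ` B \<mu>" by (metis inv2 imageI)
    qed
  qed
  note code = excedance_code_eqD[OF eq]
  have A: "A \<rho> = A \<pi>" using code(2) by (auto simp: A_def)
  have "\<rho> i < i \<longleftrightarrow> \<pi> i < i" if "i \<in> {1..n}" for i
    using code(1,2)[OF that] by linarith
  then have B: "B \<rho> = B \<pi>" unfolding B_def by blast
  have "\<pi> ` A \<pi> = \<rho> ` A \<pi>"
    unfolding imA[OF p] imA[OF r, unfolded A] using code(1,3) by (auto simp del: atLeastAtMost_iff)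
  then have eqA: "\<pi> x = \<rho> x" if "x \<in> A \<pi>" for x
    using strict_mono_on_same_image_eq[OF monoA[OF p cp] monoA[OF r cr, unfolded A]] that by blast
  have "\<pi> ` B \<pi> = \<rho> ` B \<pi>"
    unfolding imB[OF p] imB[OF r, unfolded B] using code(1,3) by (auto simp del: atLeastAtMost_iff)
  then have eqB: "\<pi> x = \<rho> x" if "x \<in> B \<pi>" for x
    using strict_mono_on_same_image_eq[OF monoB[OF p cp] monoB[OF r cr, unfolded B]] that by blast
  show "\<pi> = \<rho>"
  proof
    fix x
    show "\<pi> x = \<rho> x"
    proof (cases "x \<in> {1..n}")
      case True
      then consider "\<pi> x = x" | "x \<in> A \<pi>" | "x \<in> B \<pi>" unfolding A_def B_def by fastforce
      then show ?thesis using code(1)[OF True] eqA eqB by cases auto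
    next
      case False
      then show ?thesis using p r permutes_not_in by metis
    qed
  qed
qed

text \<open>The largest code is 1 + 1 + 2 = 4, and the restricted lambda makes each code an
  extensional function on \<open>{1..n}\<close>.\<close>

lemma card_inversions_cross_diagonal_le:
  "card {\<pi>. \<pi> permutes {1..n} \<and> inversions_cross_diagonal n \<pi>} \<le> 5 ^ n"
proof -
  have "excedance_code n ` {\<pi>. \<pi> permutes {1..n} \<and> inversions_cross_diagonal n \<pi>}
      \<subseteq> {1..n} \<rightarrow>\<^sub>E {..<5}"
    by (auto simp: excedance_code_def of_bool_def)
  then have "card {\<pi>. \<pi> permutes {1..n} \<and> inversions_cross_diagonal n \<pi>}
      \<le> card ({1..n} \<rightarrow>\<^sub>E {..<5::nat})"
    by (intro card_inj_on_le[OF inj_on_excedance_code]) (auto intro: finite_PiE)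
  also have "\<dots> = 5 ^ n" by (simp add: card_PiE)
  finally show ?thesis .
qed

text \<open>The map taking \<tau> to \<open>inv \<tau> \<circ> \<sigma>\<close> is injective and
  transfers the count to permutations whose inversions cross the diagonal.\<close>

lemma card_not_locally_parallel_le:
  assumes s: "\<sigma> permutes {1..n}"
  shows "card {\<tau>. \<tau> permutes {1..n} \<and> \<not> locally_parallel n \<sigma> \<tau>} \<le> 5 ^ n" (is "card ?N \<le> _")
proof -
  have "inj_on (\<lambda>\<tau>. inv \<tau> \<circ> \<sigma>) ?N"
  proof (rule inj_onI, clarify)
    fix \<tau> \<tau>'
    assume t: "\<tau> permutes {1..n}" "\<tau>' permutes {1..n}" and eq: "inv \<tau> \<circ> \<sigma> = inv \<tau>' \<circ> \<sigma>"
    have "inv \<tau> x = inv \<tau>' x" for x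
      using fun_cong[OF eq, of "inv \<sigma> x"] permutes_inverses(1)[OF s] by simp
    then have "inv \<tau> = inv \<tau>'" by auto
    then show "\<tau> = \<tau>'" by (metis t permutes_inv_inv)
  qed
  moreover have "(\<lambda>\<tau>. inv \<tau> \<circ> \<sigma>) ` ?N \<subseteq> {\<pi>. \<pi> permutes {1..n} \<and> inversions_cross_diagonal n \<pi>}"
  proof clarify
    fix \<tau> assume t: "\<tau> permutes {1..n}" and np: "\<not> locally_parallel n \<sigma> \<tau>"
    show "inv \<tau> \<circ> \<sigma> permutes {1..n} \<and> inversions_cross_diagonal n (inv \<tau> \<circ> \<sigma>)"
      using permutes_compose[OF s permutes_inv[OF t]]
        inversions_cross_diagonal_if_not_locally_parallel[OF s np] by simp
  qed
  moreover have "finite {\<pi>. \<pi> permutes {1..n} \<and> inversions_cross_diagonal n \<pi>}"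
    using finite_permutations[of "{1..n}"] by simp
  ultimately have "card ?N \<le> card {\<pi>. \<pi> permutes {1..n} \<and> inversions_cross_diagonal n \<pi>}"
    by (rule card_inj_on_le)
  also have "\<dots> \<le> 5 ^ n" by (rule card_inversions_cross_diagonal_le)
  finally show ?thesis .
qed

section \<open>Covering by a maximum family, and the two bounds\<close>

lemma fact_le_max_locally_parallel: "fact n \<le> max_locally_parallel n * 5 ^ n"
proof -
  obtain F where F: "locally_parallel_family n F" and c: "card F = max_locally_parallel n"
    by (rule max_locally_parallel_attained)
  have fin: "finite F" by (rule locally_parallel_family_finite[OF F])
  define N where "N \<sigma> = {\<tau>. \<tau> permutes {1..n} \<and> \<not> locally_parallel n \<sigma> \<tau>}" for \<sigma>
  have finN: "finite (N \<sigma>)" for \<sigma>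
    unfolding N_def using finite_permutations[of "{1..n}"] by simp
  \<comment> \<open>A member of \<open>F\<close> lies in its own \<open>N\<close>. Any other \<tau>
    fails to be locally parallel to some member, since otherwise inserting it would give a larger
    family.\<close>
  have "{\<tau>. \<tau> permutes {1..n}} \<subseteq> (\<Union>\<sigma>\<in>F. N \<sigma>)"
  proof clarify
    fix \<tau> assume t: "\<tau> permutes {1..n}"
    show "\<tau> \<in> (\<Union>\<sigma>\<in>F. N \<sigma>)"
    proof (cases "\<tau> \<in> F")
      case True
      then show ?thesis using t not_locally_parallel_self by (auto simp: N_def)
    next
      case False
      have "\<not> locally_parallel_family n (insert \<tau> F)"
      proof
        assume "locally_parallel_family n (insert \<tau> F)"
        from card_le_max_locally_parallel[OF this] show False using False fin c by simp
      qed
      then obtain \<sigma> where "\<sigma> \<in> F" "\<not> locally_parallel n \<sigma> \<tau>"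
        using F t locally_parallel_commute
        unfolding locally_parallel_family_def pairwise_insert by blast
      then show ?thesis using t by (auto simp: N_def)
    qed
  qed
  then have "card {\<tau>. \<tau> permutes {1..n}} \<le> card (\<Union>\<sigma>\<in>F. N \<sigma>)"
    by (intro card_mono) (auto simp: fin finN)
  also have "\<dots> \<le> (\<Sum>\<sigma>\<in>F. card (N \<sigma>))" by (rule card_UN_le[OF fin])
  also have "\<dots> \<le> (\<Sum>\<sigma>\<in>F. 5 ^ n)"
    using F card_not_locally_parallel_le
    unfolding N_def locally_parallel_family_def by (intro sum_mono) blast
  finally show ?thesis using c by (simp add: card_permutations[of _ n])
qed

theorem theorem3:
  fixes n :: nat
  assumes "n \<ge> 1"
  shows "fact n / 6 ^ n < real (max_locally_parallel n)
    \<and> real (max_locally_parallel n) \<le> fact n / 6 ^ (n div 3)"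
proof
  let ?P = "max_locally_parallel n"
  \<comment> \<open>Strictness comes from weakening 5 to 6, which requires a positive exponent and a
    nonzero factor.\<close>
  have "?P \<noteq> 0" using fact_le_max_locally_parallel[of n] by (metis fact_nonzero le_zero_eq mult_0)
  moreover have "(5::nat) ^ n < 6 ^ n" using assms by (intro power_strict_mono) auto
  ultimately have "fact n < ?P * 6 ^ n"
    using fact_le_max_locally_parallel[of n] by (metis le_less_trans mult_less_mono2 neq0_conv)
  then have "real (fact n) < real (?P * 6 ^ n)" by (simp only: of_nat_less_iff)
  then show "fact n / 6 ^ n < real ?P" by (simp add: divide_simps)
next
  obtain F where "locally_parallel_family n F" "card F = max_locally_parallel n"
    by (rule max_locally_parallel_attained)
  then have "max_locally_parallel n * 6 ^ (n div 3) \<le> fact n"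
    using card_locally_parallel_family_le by metis
  then have "real (max_locally_parallel n * 6 ^ (n div 3)) \<le> real (fact n)"
    by (simp only: of_nat_le_iff)
  then show "real (max_locally_parallel n) \<le> fact n / 6 ^ (n div 3)" by (simp add: divide_simps)
qed

end
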